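(* Let $X=\{0,1,\ldots,K\}$ and let $Y=\{\{0\},(0,1),\{1\},(1,2),\ldots,\{K-1\},(K-1,K),\{K\}\}$ (a finite set whose elements are these singletons and open intervals). For each $n$ let $f_n:X^n\to Y$ map $(x_1,\ldots,x_n)$ to the unique element of $Y$ containing the average $\frac1n\sum_{i=1}^n x_i$. Then the family $(f_n)$ is computable (with finite memory).
   Context: Model of computation. Let $X$ (initial values), $Y$ (outputs), $M$ (messages) be sets and, for each integer $d\ge 0$, let $Z_d$ be a set (memory states); each of $Y$, $M$, $Z_d$ contains a distinguished element $\emptyset$. An automaton family is a sequence of maps $(A_d)_{d\ge0}$, $A_d: X\times Z_d\times Y\times M^d\to X\times Z_d\times Y\times M^d$, which leave the first coordinate unchanged. A network is a finite connected simple undirected graph $G=(V,E)$ with $V=\{1,\ldots,n\}$, together with a port labeling: for each node $i$ of degree $d(i)$, a bijection $\ell_i$ from the set of neighbors of $i$ to $\{1,\ldots,d(i)\}$. Given initial values $x_1,\ldots,x_n\in X$, the execution is: node $i$ has state $S_i(t)=(x_i,z_i(t),y_i(t),m_{i,1}(t),\ldots,m_{i,d(i)}(t))$ with $z_i(0)=y_i(0)=m_{i,k}(0)=\emptyset$ ($m_{i,p}(t)$ is the message $i$ sends through its port $p$), and $S_i(t+1)=A_{d(i)}(x_i,z_i(t),y_i(t),\mu_{i,1}(t),\ldots,\mu_{i,d(i)}(t))$, where if $j$ is the neighbor of $i$ with $\ell_i(j)=k$ then $\mu_{i,k}(t)=m_{j,\ell_j(i)}(t)$. An element $y^*\in Y$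 is the final output of the execution if there is $t'$ with $y_i(t)=y^*$ for all nodes $i$ and all $t\ge t'$. Finite memory: $X,Y,M$ and all $Z_d$ are finite and $\log|Z_d|\le Cd$ for all $d\ge1$, for a constant $C$ independent of $d$. A family of functions $(f_n:X^n\to Y)_{n\ge1}$ is computable if there exists an automaton family with finite memory such that for every $n$, every network with $n$ nodes (every connected graph and every port labeling), and every $x\in X^n$, the execution has a final output equal to $f_n(x_1,\ldots,x_n)$. *)

theory Defs
  imports Complex_Main
begin

text \<open>Nodes are 1..n. E is the (symmetric, irreflexive) adjacency relation;
  l i j is the port number (in 1..deg i) under which node i sees its neighbour j.\<close>

definition nbrs :: "(nat \<Rightarrow> nat \<Rightarrow> bool) \<Rightarrow> nat \<Rightarrow> nat set" where
  "nbrs E i = {j. E i j}"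

definition deg :: "(nat \<Rightarrow> nat \<Rightarrow> bool) \<Rightarrow> nat \<Rightarrow> nat" where
  "deg E i = card (nbrs E i)"

definition network :: "nat \<Rightarrow> (nat \<Rightarrow> nat \<Rightarrow> bool) \<Rightarrow> (nat \<Rightarrow> nat \<Rightarrow> nat) \<Rightarrow> bool" where
  "network n E l \<longleftrightarrow>
     n \<ge> 1 \<and>
     (\<forall>i j. E i j \<longrightarrow> i \<in> {1..n} \<and> j \<in> {1..n}) \<and>
     (\<forall>i j. E i j \<longrightarrow> E j i) \<and>
     (\<forall>i. \<not> E i i) \<and>
     (\<forall>i\<in>{1..n}. \<forall>j\<in>{1..n}. E\<^sup>*\<^sup>* i j) \<and>
     (\<forall>i\<in>{1..n}. bij_betw (l i) (nbrs E i) {1..deg E i})"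

definition port_nbr :: "(nat \<Rightarrow> nat \<Rightarrow> bool) \<Rightarrow> (nat \<Rightarrow> nat \<Rightarrow> nat) \<Rightarrow> nat \<Rightarrow> nat \<Rightarrow> nat" where
  "port_nbr E l i k = (THE j. E i j \<and> l i j = k)"

text \<open>A node state is (x, z, y, [m_1,...,m_d]); message m_p is sent through port p
  (list index p-1). A d is the automaton for degree d.\<close>

type_synonym ('x,'z,'y,'m) nstate = "'x \<times> 'z \<times> 'y \<times> 'm list"

definition msgs :: "('x,'z,'y,'m) nstate \<Rightarrow> 'm list" where
  "msgs S = snd (snd (snd S))"

definition outp :: "('x,'z,'y,'m) nstate \<Rightarrow> 'y" where
  "outp S = fst (snd (snd S))"

primrec exec ::
  "(nat \<Rightarrow> ('x,'z,'y,'m) nstate \<Rightarrow> ('x,'z,'y,'m) nstate) \<Rightarrow> 'z \<Rightarrow> 'y \<Rightarrow> 'm \<Rightarrow>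
   (nat \<Rightarrow> nat \<Rightarrow> bool) \<Rightarrow> (nat \<Rightarrow> nat \<Rightarrow> nat) \<Rightarrow> (nat \<Rightarrow> 'x) \<Rightarrow>
   nat \<Rightarrow> nat \<Rightarrow> ('x,'z,'y,'m) nstate" where
  "exec A z0 y0 m0 E l x 0 =
     (\<lambda>i. (x i, z0, y0, replicate (deg E i) m0))"
| "exec A z0 y0 m0 E l x (Suc t) =
     (\<lambda>i. case exec A z0 y0 m0 E l x t i of (xi, z, y, _) \<Rightarrow>
        A (deg E i) (xi, z, y,
          map (\<lambda>k. let j = port_nbr E l i k in
                     msgs (exec A z0 y0 m0 E l x t j) ! (l j i - 1))
              [1..<deg E i + 1]))"

definition final_output :: "nat \<Rightarrow> (nat \<Rightarrow> nat \<Rightarrow> ('x,'z,'y,'m) nstate) \<Rightarrow> 'y \<Rightarrow> bool" where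
  "final_output n S ys \<longleftrightarrow> (\<exists>t'. \<forall>t\<ge>t'. \<forall>i\<in>{1..n}. outp (S t i) = ys)"

text \<open>Memory states and messages are encoded as natural numbers (any finite set
  can be so encoded); 0 plays the role of the distinguished element.
  Zs d is the memory set Z_d, Ms the message set.\<close>

definition automaton_family ::
  "'x set \<Rightarrow> 'y set \<Rightarrow> (nat \<Rightarrow> nat set) \<Rightarrow> nat set \<Rightarrow>
   (nat \<Rightarrow> ('x,nat,'y,nat) nstate \<Rightarrow> ('x,nat,'y,nat) nstate) \<Rightarrow> bool" where
  "automaton_family Xs Ys Zs Ms A \<longleftrightarrow>
     (\<forall>d xv z y ms. xv \<in> Xs \<longrightarrow> z \<in> Zs d \<longrightarrow> y \<in> Ys \<longrightarrow> set ms \<subseteq> Ms \<longrightarrow> length ms = d \<longrightarrow>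
        (case A d (xv, z, y, ms) of (xv', z', y', ms') \<Rightarrow>
           xv' = xv \<and> z' \<in> Zs d \<and> y' \<in> Ys \<and> set ms' \<subseteq> Ms \<and> length ms' = d))"

definition finite_memory :: "'x set \<Rightarrow> 'y set \<Rightarrow> (nat \<Rightarrow> nat set) \<Rightarrow> nat set \<Rightarrow> bool" where
  "finite_memory Xs Ys Zs Ms \<longleftrightarrow>
     finite Xs \<and> finite Ys \<and> finite Ms \<and> (\<forall>d. finite (Zs d)) \<and>
     (\<exists>C::real. \<forall>d\<ge>1. log 2 (real (card (Zs d))) \<le> C * real d)"

definition computable ::
  "'x set \<Rightarrow> 'y set \<Rightarrow> 'y \<Rightarrow> (nat \<Rightarrow> (nat \<Rightarrow> 'x) \<Rightarrow> 'y) \<Rightarrow> bool" where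
  "computable Xs Ys y0 f \<longleftrightarrow>
     (\<exists>Zs Ms A. 0 \<in> Ms \<and> (\<forall>d. 0 \<in> Zs d) \<and> y0 \<in> Ys \<and>
        automaton_family Xs Ys Zs Ms A \<and> finite_memory Xs Ys Zs Ms \<and>
        (\<forall>n E l x. network n E l \<longrightarrow> (\<forall>i\<in>{1..n}. x i \<in> Xs) \<longrightarrow>
           final_output n (exec A 0 y0 0 E l x) (f n x)))"

definition Xavg :: "nat \<Rightarrow> nat set" where
  "Xavg K = {0..K}"

text \<open>Y: the singletons {k} (k \<le> K), the open intervals (k,k+1) (k < K), and the
  distinguished element, taken to be the empty set of reals.\<close>
definition Yavg :: "nat \<Rightarrow> real set set" where
  "Yavg K = {{}} \<union> {{real k} | k. k \<le> K} \<union> {{real k<..<real k + 1} | k. k < K}"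

definition favg :: "nat \<Rightarrow> nat \<Rightarrow> (nat \<Rightarrow> nat) \<Rightarrow> real set" where
  "favg K n x = (THE y. y \<in> Yavg K \<and> (\<Sum>i=1..n. real (x i)) / real n \<in> y)"

end

theory Submission
  imports Defs "HOL-Library.Countable"
begin

text \<open>
  The average is compared with every integer \<open>k \<le> K\<close> by running in parallel, for \<open>v = x - k\<close> and
  \<open>v = k - x\<close>, an anonymous test of \<open>\<Sum>i. v i > 0\<close>.

  In such a test every node starts with integer weight \<open>v i\<close> and height 0. A node of weight \<open>\<le> 0\<close> all
  of whose neighbours are at least as high raises its height by 1; a node of positive weight stays at
  height 0. Adjacent heights never differ by more than 1, so that heights modulo 3 suffice to compare
  neighbours. Negative units travel downhill, through buffers of capacity one per port, and cancel
  against the first positive weight they meet.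

  If the sum is positive, some node stays positive, heights are bounded, and eventually no node rises.
  Otherwise all positive weights disappear: else heights would become stationary, and then, by
  induction on the height, no negative unit could exist anywhere without reaching a positive node.
  From then on the minimal height grows in every step while no height grows by more than 1 per step, so
  eventually every node rises in every step. Hence the bit ``I have just risen'' is the answer.
\<close>

section \<open>Dynamics of heights and units\<close>

text \<open>
  One step of a node of weight \<open>w\<close>: \<open>held j\<close> is the unit buffered at the port towards \<open>j\<close>, \<open>sent j\<close> the
  unit in flight to \<open>j\<close>, \<open>arriving j\<close> the unit in flight from \<open>j\<close>, and \<open>free j\<close> says that \<open>j\<close> is lower
  and able to buffer a unit. Nothing is sent while \<open>sent\<close> is nonempty, because the buffer state known
  from the neighbour does not yet reflect a unit in flight.
\<close>
inductive node_step ::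
  "int \<Rightarrow> ('v \<Rightarrow> bool) \<Rightarrow> ('v \<Rightarrow> bool) \<Rightarrow> ('v \<Rightarrow> bool) \<Rightarrow> ('v \<Rightarrow> bool)
    \<Rightarrow> int \<Rightarrow> ('v \<Rightarrow> bool) \<Rightarrow> ('v \<Rightarrow> bool) \<Rightarrow> bool"
  for w held sent arriving free where
  idle: "\<not> (w > 0 \<and> (\<exists>j. held j)) \<Longrightarrow>
    \<not> (w \<le> 0 \<and> (w < 0 \<or> (\<exists>j. held j)) \<and> (\<forall>j. \<not> sent j) \<and> (\<exists>j. free j)) \<Longrightarrow>
    node_step w held sent arriving free w (\<lambda>j. held j \<or> arriving j) (\<lambda>_. False)"
| cancel: "w > 0 \<Longrightarrow> held r \<Longrightarrow>
    node_step w held sent arriving free (w - 1) (\<lambda>j. held j \<and> j \<noteq> r \<or> arriving j) (\<lambda>_. False)"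
| send_own: "w < 0 \<Longrightarrow> (\<forall>j. \<not> sent j) \<Longrightarrow> free c \<Longrightarrow>
    node_step w held sent arriving free (w + 1) (\<lambda>j. held j \<or> arriving j) (\<lambda>j. j = c)"
| send_held: "w = 0 \<Longrightarrow> held r \<Longrightarrow> (\<forall>j. \<not> sent j) \<Longrightarrow> free c \<Longrightarrow>
    node_step w held sent arriving free w (\<lambda>j. held j \<and> j \<noteq> r \<or> arriving j) (\<lambda>j. j = c)"

lemma nat_decseq_eventually_const:
  fixes f :: "nat \<Rightarrow> nat"
  assumes "\<And>t. f (Suc t) \<le> f t"
  shows "\<exists>T. \<forall>t\<ge>T. f t = f T"
proof -
  define m where "m = (LEAST m. m \<in> range f)"
  have "m \<in> range f"
    unfolding m_def by (rule LeastI_ex) blast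
  then obtain T where T: "f T = m" by auto
  have "f t = f T" if "t \<ge> T" for t
    using lift_Suc_antimono_le[of f, OF assms that] T Least_le[of "\<lambda>m. m \<in> range f" "f t"]
    by (simp add: m_def)
  then show ?thesis by blast
qed

lemma nat_incseq_bounded_eventually_const:
  fixes f :: "nat \<Rightarrow> nat"
  assumes "\<And>t. f t \<le> f (Suc t)" and "\<And>t. f t \<le> m"
  shows "\<exists>T. \<forall>t\<ge>T. f t = f T"
proof -
  have "\<exists>T. \<forall>t\<ge>T. m - f t = m - f T"
    by (rule nat_decseq_eventually_const) (simp add: assms(1) diff_le_mono2)
  then show ?thesis
    by (metis assms(2) diff_diff_cancel)
qed

lemma finite_uniform_threshold:
  fixes P :: "'v \<Rightarrow> nat \<Rightarrow> bool"
  assumes "finite V" and "\<And>i. i \<in> V \<Longrightarrow> \<exists>T. \<forall>t\<ge>T. P i t"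
  shows "\<exists>T. \<forall>t\<ge>T. \<forall>i\<in>V. P i t"
  using assms eventually_ball_finite[of V "\<lambda>t i. P i t" sequentially]
  by (simp add: eventually_sequentially)

text \<open>\<open>h\<close> is the true, unbounded height and exists only for the analysis.
  \<open>low\<close> and \<open>rises\<close> are phrased modulo 3 because a node learns no more
  than that about its neighbours; \<open>low_iff\<close> and \<open>rises_iff\<close> recover the
  true comparisons.\<close>

locale height_dynamics =
  fixes V :: "'v set" and E :: "'v \<Rightarrow> 'v \<Rightarrow> bool"
    and w :: "nat \<Rightarrow> 'v \<Rightarrow> int" and h :: "nat \<Rightarrow> 'v \<Rightarrow> nat"
    and B F :: "nat \<Rightarrow> 'v \<Rightarrow> 'v \<Rightarrow> bool"
  fixes low rises
  defines "low t i j \<equiv> (h t j + 1) mod 3 = h t i mod 3"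
  defines "rises t i \<equiv> w t i \<le> 0 \<and> \<not> (\<exists>j. E i j \<and> low t i j)"
  assumes finite_V: "finite V" and V_nonempty: "V \<noteq> {}"
    and sym: "E i j \<Longrightarrow> E j i" and edge_V: "E i j \<Longrightarrow> i \<in> V"
    and conn: "i \<in> V \<Longrightarrow> j \<in> V \<Longrightarrow> E\<^sup>*\<^sup>* i j"
    and h_0: "h 0 i = 0" and h_Suc: "i \<in> V \<Longrightarrow> h (Suc t) i = h t i + of_bool (rises t i)"
    and B_0: "\<not> B 0 i j" and F_0: "\<not> F 0 i j"
    and B_edge: "B t i j \<Longrightarrow> E i j" and F_edge: "F t i j \<Longrightarrow> E i j"
    and step: "i \<in> V \<Longrightarrow> node_step (w t i) (B t i) (F t i) (\<lambda>j. F t j i)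
        (\<lambda>j. E i j \<and> low t i j \<and> \<not> B t j i) (w (Suc t) i) (B (Suc t) i) (F (Suc t) i)"
begin

section \<open>Heights of adjacent nodes\<close>

lemma edge_V2: "E i j \<Longrightarrow> j \<in> V"
  using sym edge_V by blast

text \<open>The gap could grow to 2 only if \<open>i\<close> rose while one above \<open>j\<close>,
  but then \<open>j\<close> is \<open>low\<close> for \<open>i\<close> and blocks the rise. Only the
  trivial direction from true heights to residues is used, so there is no circularity with
  \<open>low_iff\<close>.\<close>

lemma h_edge: "E i j \<Longrightarrow> h t i \<le> h t j + 1"
proof (induction t arbitrary: i j)
  case 0
  then show ?case by (simp add: h_0)
next
  case (Suc t)
  have *: "h t i \<le> h t j + 1" "h t j \<le> h t i + 1"
    using Suc sym by blast+
  show ?case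
  proof (cases "h t i = h t j + 1")
    case True
    then have "low t i j" by (simp add: low_def)
    then have "\<not> rises t i" using Suc.prems by (auto simp: rises_def)
    then show ?thesis using True Suc.prems edge_V edge_V2 by (simp add: h_Suc)
  next
    case False
    then show ?thesis using * Suc.prems edge_V edge_V2 by (simp add: h_Suc)
  qed
qed

text \<open>By \<open>h_edge\<close> the difference of the heights is -1, 0 or 1, and these are
  distinct modulo 3.\<close>

lemma low_iff: assumes "E i j" shows "low t i j \<longleftrightarrow> h t i = h t j + 1"
proof -
  have "h t i \<le> h t j + 1" "h t j \<le> h t i + 1"
    using assms h_edge sym by blast+
  then consider "h t i = h t j + 1" | "h t i = h t j" | "h t j = h t i + 1" by linarith
  then show ?thesis
    by cases (auto simp: low_def, presburger+)
qed

lemma rises_iff: "rises t i \<longleftrightarrow> w t i \<le> 0 \<and> \<not> (\<exists>j. E i j \<and> h t i = h t j + 1)"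
  using low_iff by (auto simp: rises_def)

text \<open>Units never collide in a buffer: a unit departs only if the target buffer is empty and
  its sender has nothing in flight, so nothing can enter that buffer during the departure
  step.\<close>

lemma F_not_B: "F t i j \<Longrightarrow> \<not> B t j i"
proof (cases t)
  case (Suc s)
  assume F: "F t i j"
  have E: "E i j" using F F_edge by blast
  have 1: "\<not> B s j i \<and> \<not> F s i j"
    using step[of i s] edge_V[OF E] F unfolding Suc
    by (auto elim!: node_step.cases)
  then show ?thesis
    using step[of j s] edge_V2[OF E] unfolding Suc
    by (auto elim!: node_step.cases)
qed (simp add: F_0)

lemma F_step: "F t i j \<Longrightarrow> B (Suc t) j i"
  using step[of j t] edge_V2[OF F_edge, of t i j] by (auto elim!: node_step.cases)

section \<open>Conservation of the total weight\<close>

definition num :: "('v \<Rightarrow> bool) \<Rightarrow> int" where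
  "num P = (\<Sum>j\<in>V. if P j then 1 else 0)"

lemma num_False: "num (\<lambda>_. False) = 0"
  by (simp add: num_def)

lemma num_eq: "c \<in> V \<Longrightarrow> num (\<lambda>j. j = c) = 1"
  using finite_V by (simp add: num_def)

lemma num_disj:
  assumes "\<And>j. \<not> (P j \<and> Q j)"
  shows "num (\<lambda>j. P j \<or> Q j) = num P + num Q"
  unfolding num_def sum.distrib[symmetric] by (rule sum.cong) (use assms in auto)

lemma num_remove:
  assumes "P r" "r \<in> V"
  shows "num (\<lambda>j. P j \<and> j \<noteq> r) = num P - 1"
proof -
  have "num P = num (\<lambda>j. (P j \<and> j \<noteq> r) \<or> j = r)"
    unfolding num_def by (rule sum.cong) (use assms in auto)
  also have "\<dots> = num (\<lambda>j. P j \<and> j \<noteq> r) + 1"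
    using num_disj[of "\<lambda>j. P j \<and> j \<noteq> r" "\<lambda>j. j = r"] num_eq[OF assms(2)] by simp
  finally show ?thesis by simp
qed

lemma num_nonneg: "num P \<ge> 0"
  by (simp add: num_def sum_nonneg)

text \<open>Buffered and flying units are negative, hence subtracted. A flying unit is charged to
  its sender.\<close>

definition units :: "nat \<Rightarrow> 'v \<Rightarrow> int" where
  "units t i = w t i - num (B t i) - num (F t i)"

definition total :: "nat \<Rightarrow> int" where
  "total t = (\<Sum>i\<in>V. units t i)"

text \<open>The right-hand side charges flying units to the receiver instead. Cancelling and sending
  change the weight and the unit counts by matching amounts; \<open>F_not_B\<close> ensures that an
  arriving unit does not merge with a buffered one.\<close>

lemma units_Suc:
  assumes i: "i \<in> V"
  shows "units (Suc t) i = w t i - num (B t i) - num (\<lambda>j. F t j i)"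
proof -
  have disj: "\<not> (B t i j \<and> F t j i)" for j using F_not_B by blast
  have disj': "\<not> ((B t i j \<and> j \<noteq> r) \<and> F t j i)" for j r using F_not_B by blast
  have B_V: "B t i j \<Longrightarrow> j \<in> V" for j using B_edge edge_V2 by blast
  show ?thesis
    using step[OF i, of t]
  proof cases
    case idle
    then show ?thesis
      by (simp only: units_def num_disj[OF disj] num_False)
  next
    case (cancel r)
    then show ?thesis
      by (simp only: units_def num_disj[OF disj'] num_False num_remove[of "B t i", OF _ B_V])
  next
    case (send_own c)
    then have "c \<in> V" using edge_V2 by blast
    with send_own show ?thesis
      by (simp only: units_def num_disj[OF disj] num_eq)
  next
    case (send_held r c)
    then have "c \<in> V" using edge_V2 by blast
    with send_held show ?thesis
      by (simp only: units_def num_disj[OF disj'] num_eq num_remove[of "B t i", OF _ B_V])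
  qed
qed

text \<open>Summed over all nodes, charging flights to receivers or to senders gives the same total,
  so \<open>units_Suc\<close> yields invariance.\<close>

lemma total_const: "total t = (\<Sum>i\<in>V. w 0 i)"
proof (induction t)
  case 0
  then show ?case by (simp add: total_def units_def num_def B_0 F_0)
next
  case (Suc t)
  have "total (Suc t) = (\<Sum>i\<in>V. w t i - num (B t i) - num (\<lambda>j. F t j i))"
    unfolding total_def by (rule sum.cong) (auto simp: units_Suc)
  also have "\<dots> = total t"
    using sum.swap[of "\<lambda>i j. if F t j i then 1 else 0 :: int" V V]
    by (simp add: total_def units_def num_def sum_subtractf)
  finally show ?case using Suc by simp
qed

section \<open>Long-run behaviour of positive weights and of rises\<close>

lemma pos_w_antimono: "i \<in> V \<Longrightarrow> nat (w (Suc t) i) \<le> nat (w t i)"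
  using step[of i t] by (auto elim!: node_step.cases)

lemma pos_w_antimono_le: "i \<in> V \<Longrightarrow> s \<le> t \<Longrightarrow> nat (w t i) \<le> nat (w s i)"
  using lift_Suc_antimono_le[of "\<lambda>t. nat (w t i)"] pos_w_antimono by blast

lemma pos_eventually_const: "\<exists>T. \<forall>t\<ge>T. \<forall>i\<in>V. nat (w t i) = nat (w T i)"
proof -
  have "\<exists>T. \<forall>t\<ge>T. nat (w (Suc t) i) = nat (w t i)" if "i \<in> V" for i
    using nat_decseq_eventually_const[of "\<lambda>t. nat (w t i)"] pos_w_antimono[OF that]
    by (metis le_Suc_eq)
  then obtain T where T: "\<And>t i. t \<ge> T \<Longrightarrow> i \<in> V \<Longrightarrow> nat (w (Suc t) i) = nat (w t i)"
    using finite_uniform_threshold[OF finite_V, of "\<lambda>i t. nat (w (Suc t) i) = nat (w t i)"] by blast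
  have "nat (w t i) = nat (w T i)" if "t \<ge> T" "i \<in> V" for t i
    using that by (induction t rule: dec_induct) (auto simp: T)
  then show ?thesis by blast
qed

text \<open>Positive parts never increase, so a node that is positive now was positive at all
  earlier times and never rose.\<close>

lemma pos_h_0: "i \<in> V \<Longrightarrow> w t i > 0 \<Longrightarrow> h t i = 0"
proof (induction t)
  case (Suc t)
  then have "w t i > 0" using pos_w_antimono[of i t] by linarith
  then show ?case using Suc by (simp add: h_Suc rises_def)
qed (simp add: h_0)

text \<open>Once the positive parts are constant, a positive node \<open>r\<close> has been and
  remains positive, so it is pinned at height 0. By \<open>h_edge\<close> along paths from
  \<open>r\<close>, every height is bounded; being nondecreasing, it becomes stationary.\<close>

lemma eventually_no_rise:
  assumes pos: "\<And>t. \<exists>i\<in>V. w t i > 0"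
  shows "\<exists>T. \<forall>t\<ge>T. \<forall>i\<in>V. \<not> rises t i"
proof -
  obtain T where T: "\<And>t i. t \<ge> T \<Longrightarrow> i \<in> V \<Longrightarrow> nat (w t i) = nat (w T i)"
    using pos_eventually_const by blast
  obtain r where r: "r \<in> V" "w T r > 0" using pos by blast
  \<comment> \<open>After \<open>T\<close> by constancy of the positive part, before
    \<open>T\<close> because it can only have been larger.\<close>
  have "w t r > 0" for t
    using T[of t r] pos_w_antimono_le[of r t T] r by (cases "t \<ge> T") auto
  then have hr: "h t r = 0" for t using pos_h_0 r by blast
  have bound: "\<exists>m. \<forall>t. h t i \<le> m" if "i \<in> V" for i
    using conn[OF r(1) that]
  proof (induction rule: rtranclp_induct)
    case base
    then show ?case by (auto simp: hr)
  next
    case (step i j)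
    then obtain m where "\<And>t. h t i \<le> m" by blast
    then have "h t j \<le> m + 1" for t
      using h_edge[OF sym[OF step(2)], of t] by (meson add_le_mono1 order.trans)
    then show ?case by blast
  qed
  have "\<exists>T. \<forall>t\<ge>T. \<not> rises t i" if i: "i \<in> V" for i
  proof -
    obtain m where "\<And>t. h t i \<le> m" using bound[OF i] by blast
    then obtain T where "\<forall>t\<ge>T. h t i = h T i"
      using nat_incseq_bounded_eventually_const[of "\<lambda>t. h t i" m] i by (auto simp: h_Suc)
    then have "h (Suc t) i = h t i" if "t \<ge> T" for t
      using that by (metis le_Suc_eq)
    then show ?thesis using i by (auto simp: h_Suc)
  qed
  then show ?thesis by (rule finite_uniform_threshold[OF finite_V])
qed

text \<open>A node of minimal height has no lower neighbour and rises, so the minimum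
  \<open>mn\<close> gains at least 1 per step. The excess of a node over \<open>mn\<close> is then
  nonincreasing and finally constant, which forces that node to rise each time.\<close>

lemma eventually_all_rise:
  assumes npos: "\<And>t i. t \<ge> T0 \<Longrightarrow> i \<in> V \<Longrightarrow> w t i \<le> 0"
  shows "\<exists>T. \<forall>t\<ge>T. \<forall>i\<in>V. rises t i"
proof -
  define mn where "mn t = Min (h t ` V)" for t
  have mn_le: "mn t \<le> h t i" if "i \<in> V" for t i
    using finite_V that by (simp add: mn_def)
  have mn_Suc: "mn t + 1 \<le> mn (Suc t)" if t: "t \<ge> T0" for t
  proof -
    have "mn t + 1 \<le> h (Suc t) i" if i: "i \<in> V" for i
    proof (cases "h t i = mn t")
      case True
      have "h t i \<noteq> h t j + 1" if "E i j" for j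
        using mn_le[OF edge_V2[OF that], of t] True by linarith
      then have "rises t i"
        using npos[OF t i] by (auto simp: rises_iff)
      then show ?thesis using True i by (simp add: h_Suc)
    next
      case False
      then show ?thesis using mn_le[OF i, of t] i by (simp add: h_Suc)
    qed
    then show ?thesis
      unfolding mn_def[of "Suc t"] using finite_V V_nonempty by (subst Min_ge_iff) auto
  qed
  have "\<exists>T. \<forall>t\<ge>T. rises t i" if i: "i \<in> V" for i
  proof -
    have "h (Suc t) i - mn (Suc t) \<le> h t i - mn t" if "t \<ge> T0" for t
    proof -
      have "h (Suc t) i \<le> h t i + 1" using i by (simp add: h_Suc)
      then show ?thesis using mn_Suc[OF that] by linarith
    qed
    then obtain T where T: "\<And>t. t \<ge> T \<Longrightarrow> h (t + T0) i - mn (t + T0) = h (T + T0) i - mn (T + T0)"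
      using nat_decseq_eventually_const[of "\<lambda>t. h (t + T0) i - mn (t + T0)"] by auto
    have "rises t i" if "t \<ge> T + T0" for t
    proof -
      have "h (Suc t) i - mn (Suc t) = h t i - mn t"
        using T[of "t - T0"] T[of "Suc t - T0"] that by (simp add: Suc_diff_le)
      then have "h (Suc t) i \<ge> h t i + 1"
        using mn_Suc[of t] that mn_le[OF i, of t] mn_le[OF i, of "Suc t"] by linarith
      then show ?thesis using i by (cases "rises t i") (simp_all add: h_Suc)
    qed
    then show ?thesis by blast
  qed
  then show ?thesis by (rule finite_uniform_threshold[OF finite_V])
qed

section \<open>The limit behaviour decides the sign of the sum\<close>

lemma test_positive:
  assumes "(\<Sum>i\<in>V. w 0 i) > 0"
  shows "\<exists>T. \<forall>t\<ge>T. \<forall>i\<in>V. \<not> rises t i"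
proof (rule eventually_no_rise)
  fix t
  show "\<exists>i\<in>V. w t i > 0"
  proof (rule ccontr)
    assume "\<not> ?thesis"
    then have "units t i \<le> 0" if "i \<in> V" for i
      using that num_nonneg[of "B t i"] num_nonneg[of "F t i"] by (fastforce simp: units_def)
    then have "total t \<le> 0" unfolding total_def by (simp add: sum_nonpos)
    then show False using assms total_const by simp
  qed
qed

text \<open>Strong induction on the height of the node. A unit at a positive node would be cancelled
  and change a constant positive part; at any other node it would be sent downhill and then sit in
  the buffer of a lower node, against the induction hypothesis. The strict \<open>t > T\<close>
  leaves room for the preceding step, in which a flight seen at \<open>t\<close> was
  started.\<close>

lemma no_unit_left:
  assumes pos: "\<And>t i. t \<ge> T \<Longrightarrow> i \<in> V \<Longrightarrow> nat (w t i) = nat (w T i)"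
    and stat: "\<And>t i. t \<ge> T \<Longrightarrow> i \<in> V \<Longrightarrow> \<not> rises t i"
    and i: "i \<in> V" and t: "t > T"
  shows "\<not> (w t i < 0 \<or> (\<exists>j. B t i j))"
  using i t
proof (induction "h t i" arbitrary: t i rule: less_induct)
  case less
  have tT: "t \<ge> T" using less.prems by simp
  show ?case
  proof
    assume unit: "w t i < 0 \<or> (\<exists>j. B t i j)"
    \<comment> \<open>Needed at two times: at \<open>t\<close>, so that nothing blocks sending, and
      at \<open>Suc t\<close>, to refute the resulting flight.\<close>
    have noF: "\<not> F s i j" if s: "s > T" "h s i = h t i" for s j
    proof
      assume F: "F s i j"
      obtain u where u: "s = Suc u" "u \<ge> T" using s by (cases s) auto
      have E: "E i j" using F F_edge by blast
      have "low u i j" using step[of i u] F less.prems(1) u(1)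
        by (auto elim!: node_step.cases)
      then have "h s i = h s j + 1"
        using low_iff[OF E] stat[OF u(2)] less.prems(1) edge_V2[OF E] u(1) by (simp add: h_Suc)
      then have "h (Suc s) j < h t i"
        using s stat[of s j] edge_V2[OF E] by (simp add: h_Suc)
      then show False
        using less.hyps[of "Suc s" j] edge_V2[OF E] F_step[OF F] s by auto
    qed
    show False
    proof (cases "w t i > 0")
      case True
      then have "\<exists>j. B t i j" using unit by auto
      then have "w (Suc t) i = w t i - 1"
        using step[of i t] less.prems True by (auto elim!: node_step.cases)
      then show False
        using True pos[of t i] pos[of "Suc t" i] less.prems by auto
    next
      case False
      \<comment> \<open>A nonpositive node that does not rise must have a lower neighbour.\<close>
      then obtain j where j: "E i j" "h t i = h t j + 1"
        using stat[OF tT less.prems(1)] by (auto simp: rises_iff)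
      have "\<not> B t j i"
        using less.hyps[of t j] j less.prems edge_V2 by auto
      then have free: "E i j \<and> low t i j \<and> \<not> B t j i"
        using j by (simp add: low_iff)
      have "\<exists>c. F (Suc t) i c"
        using step[of i t] less.prems(1)
        by (cases rule: node_step.cases) (use free unit False noF less.prems(2) in auto)
      moreover have "h (Suc t) i = h t i"
        using stat[OF tT less.prems(1)] less.prems by (simp add: h_Suc)
      ultimately show False using noF less.prems by auto
    qed
  qed
qed

text \<open>If positive weight survived forever, heights would become stationary and
  \<open>no_unit_left\<close> would clear all negative contributions. The conserved total would then
  be positive.\<close>

lemma test_nonpositive:
  assumes "(\<Sum>i\<in>V. w 0 i) \<le> 0"
  shows "\<exists>T. \<forall>t\<ge>T. \<forall>i\<in>V. rises t i"
proof (cases "\<forall>t. \<exists>i\<in>V. w t i > 0")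
  case False
  then obtain T where T: "\<And>i. i \<in> V \<Longrightarrow> w T i \<le> 0" by (auto simp: not_less)
  show ?thesis
  proof (rule eventually_all_rise)
    show "w t i \<le> 0" if "t \<ge> T" "i \<in> V" for t i
      using T[OF that(2)] pos_w_antimono_le[OF that(2) that(1)] by simp
  qed
next
  case True
  obtain T1 where T1: "\<And>t i. t \<ge> T1 \<Longrightarrow> i \<in> V \<Longrightarrow> nat (w t i) = nat (w T1 i)"
    using pos_eventually_const by blast
  obtain T2 where T2: "\<And>t i. t \<ge> T2 \<Longrightarrow> i \<in> V \<Longrightarrow> \<not> rises t i"
    using eventually_no_rise True by blast
  define T where "T = max T1 T2"
  have none: "\<not> (w t i < 0 \<or> (\<exists>j. B t i j))" if "i \<in> V" "t > T" for i t
  proof (rule no_unit_left[of T])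
    show "nat (w t i) = nat (w T i)" if "t \<ge> T" "i \<in> V" for t i
      using T1[of t i] T1[of T i] that by (simp add: T_def)
    show "\<not> rises t i" if "t \<ge> T" "i \<in> V" for t i
      using T2[of t i] that by (simp add: T_def)
  qed (use that in auto)
  \<comment> \<open>A unit in flight would be buffered one step later, which \<open>none\<close>
    excludes.\<close>
  have noF: "\<not> F (Suc T) i j" for i j
    using F_step[of "Suc T" i j] none[of j "Suc (Suc T)"] F_edge[of "Suc T" i j] edge_V2[of i j]
    by auto
  have "units (Suc T) i = w (Suc T) i" if "i \<in> V" for i
    using none[OF that, of "Suc T"] noF by (simp add: units_def num_def)
  then have "total (Suc T) = (\<Sum>i\<in>V. w (Suc T) i)"
    unfolding total_def by simp
  moreover have "(\<Sum>i\<in>V. w (Suc T) i) > 0"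
  proof -
    obtain r where "r \<in> V" "w (Suc T) r > 0" using True by blast
    then show ?thesis
      using none finite_V by (intro sum_pos2[of V r]) (auto simp: not_less)
  qed
  ultimately show ?thesis using assms total_const by simp
qed

end

section \<open>The automaton for a single test\<close>

text \<open>
  A local state consists of the weight, the height modulo 3, whether the last step was a rise, the
  buffers and the outgoing units per port. A message consists of the height modulo 3, the buffer state
  of the port and the unit sent through it. Lists are indexed by port number minus 1.
\<close>
type_synonym loc = "int \<times> nat \<times> bool \<times> bool list \<times> bool list"
type_synonym lmsg = "nat \<times> bool \<times> bool"

definition loc_init :: "int \<Rightarrow> nat \<Rightarrow> loc" where
  "loc_init w d = (w, 0, False, replicate d False, replicate d False)"

fun risen :: "loc \<Rightarrow> bool" where
  "risen (w, h, r, bs, os) = r"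

fun loc_send :: "loc \<Rightarrow> nat \<Rightarrow> lmsg" where
  "loc_send (w, h, r, bs, os) k = (h, bs ! k, os ! k)"

text \<open>\<open>LEAST\<close> merely fixes a deterministic choice of port; it is consulted only
  under \<open>cancel\<close> or \<open>send\<close>, which guarantee that a suitable port
  exists.\<close>

fun loc_step :: "loc \<Rightarrow> lmsg list \<Rightarrow> loc" where
  "loc_step (w, h, r, bs, os) ms =
    (let d = length bs;
         low = (\<lambda>k. (fst (ms ! k) + 1) mod 3 = h);
         free = (\<lambda>k. k < d \<and> low k \<and> \<not> fst (snd (ms ! k)));
         held = (\<lambda>k. k < d \<and> bs ! k);
         rise = (w \<le> 0 \<and> \<not> (\<exists>k<d. low k));
         cancel = (w > 0 \<and> (\<exists>k. held k));
         send = (w \<le> 0 \<and> (w < 0 \<or> (\<exists>k. held k)) \<and> \<not> (\<exists>k<d. os ! k) \<and> (\<exists>k. free k))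
     in (if cancel then w - 1 else if send \<and> w < 0 then w + 1 else w,
         if rise then (h + 1) mod 3 else h,
         rise,
         map (\<lambda>k. bs ! k \<and> \<not> ((cancel \<or> send \<and> w = 0) \<and> k = (LEAST k. held k))
           \<or> snd (snd (ms ! k))) [0..<d],
         map (\<lambda>k. send \<and> k = (LEAST k. free k)) [0..<d]))"

text \<open>The bijection \<open>p\<close> carries conditions on ports to conditions on neighbours;
  the least held or free port is the image of some neighbour, which serves as the witness
  \<open>r\<close> or \<open>c\<close> of the abstract rule.\<close>

lemma loc_step_node_step:
  assumes bij: "bij_betw p N {..<d}" and len: "length bs = d" "length os = d"
    and step: "loc_step (w, h, r, bs, os) ms = (w', h', r', bs', os')"
  shows "node_step w (\<lambda>j. j \<in> N \<and> bs ! p j) (\<lambda>j. j \<in> N \<and> os ! p j)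
      (\<lambda>j. j \<in> N \<and> snd (snd (ms ! p j)))
      (\<lambda>j. j \<in> N \<and> (fst (ms ! p j) + 1) mod 3 = h \<and> \<not> fst (snd (ms ! p j)))
      w' (\<lambda>j. j \<in> N \<and> bs' ! p j) (\<lambda>j. j \<in> N \<and> os' ! p j)" (is ?step)
    and "r' \<longleftrightarrow> w \<le> 0 \<and> \<not> (\<exists>j\<in>N. (fst (ms ! p j) + 1) mod 3 = h)" (is ?rise)
    and "h' = (if r' then (h + 1) mod 3 else h)"
    and "length bs' = d" and "length os' = d"
proof -
  have ex: "(\<exists>k. k < d \<and> Q k) \<longleftrightarrow> (\<exists>j\<in>N. Q (p j))" for Q
    using bij_betw_imp_surj_on[OF bij] by (metis imageE imageI lessThan_iff)
  have p_less: "p j < d" if "j \<in> N" for j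
    using bij that by (auto dest: bij_betwE)
  have inj: "p i = p j \<longleftrightarrow> i = j" if "i \<in> N" "j \<in> N" for i j
    using bij that by (auto simp: bij_betw_def inj_on_def)
  define free where "free k \<longleftrightarrow> k < d \<and> (fst (ms ! k) + 1) mod 3 = h \<and> \<not> fst (snd (ms ! k))" for k
  define held where "held k \<longleftrightarrow> k < d \<and> bs ! k" for k
  define cancel where "cancel \<longleftrightarrow> w > 0 \<and> (\<exists>k. held k)"
  define send where
    "send \<longleftrightarrow> w \<le> 0 \<and> (w < 0 \<or> (\<exists>k. held k)) \<and> \<not> (\<exists>k<d. os ! k) \<and> (\<exists>k. free k)"
  have "loc_step (w, h, r, bs, os) ms =
    (if cancel then w - 1 else if send \<and> w < 0 then w + 1 else w,
     if w \<le> 0 \<and> \<not> (\<exists>k<d. (fst (ms ! k) + 1) mod 3 = h) then (h + 1) mod 3 else h,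
     w \<le> 0 \<and> \<not> (\<exists>k<d. (fst (ms ! k) + 1) mod 3 = h),
     map (\<lambda>k. bs ! k \<and> \<not> ((cancel \<or> send \<and> w = 0) \<and> k = (LEAST k. held k))
       \<or> snd (snd (ms ! k))) [0..<d],
     map (\<lambda>k. send \<and> k = (LEAST k. free k)) [0..<d])"
    by (simp only: loc_step.simps Let_def len cancel_def send_def free_def held_def)
  from this[unfolded step prod.inject]
  have w': "w' = (if cancel then w - 1 else if send \<and> w < 0 then w + 1 else w)"
    and r': "r' \<longleftrightarrow> w \<le> 0 \<and> \<not> (\<exists>k<d. (fst (ms ! k) + 1) mod 3 = h)"
    and h': "h' = (if r' then (h + 1) mod 3 else h)"
    and bs': "bs' = map (\<lambda>k. bs ! k \<and> \<not> ((cancel \<or> send \<and> w = 0) \<and> k = (LEAST k. held k))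
           \<or> snd (snd (ms ! k))) [0..<d]"
    and os': "os' = map (\<lambda>k. send \<and> k = (LEAST k. free k)) [0..<d]"
    by blast+
  show ?rise by (simp add: r' ex)
  show "h' = (if r' then (h + 1) mod 3 else h)" by (rule h')
  show "length bs' = d" "length os' = d" by (simp_all add: bs' os')
  have held_ex: "(\<exists>k. held k) \<longleftrightarrow> (\<exists>j. j \<in> N \<and> bs ! p j)"
    using ex[of "\<lambda>k. bs ! k"] by (auto simp: held_def)
  have free_ex: "(\<exists>k. free k) \<longleftrightarrow>
      (\<exists>j. j \<in> N \<and> (fst (ms ! p j) + 1) mod 3 = h \<and> \<not> fst (snd (ms ! p j)))"
    using ex[of "\<lambda>k. (fst (ms ! k) + 1) mod 3 = h \<and> \<not> fst (snd (ms ! k))"]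
    by (auto simp: free_def)
  have os_ex: "(\<exists>k<d. os ! k) \<longleftrightarrow> (\<exists>j. j \<in> N \<and> os ! p j)"
    using ex[of "\<lambda>k. os ! k"] by auto
  have get_held: "\<exists>q\<in>N. p q = (LEAST k. held k) \<and> bs ! p q" if "\<exists>k. held k"
    using LeastI_ex[OF that] ex[of "\<lambda>k. k = (LEAST k. held k)"] by (auto simp: held_def)
  have get_free: "\<exists>c\<in>N. p c = (LEAST k. free k) \<and> (fst (ms ! p c) + 1) mod 3 = h
      \<and> \<not> fst (snd (ms ! p c))" if "\<exists>k. free k"
    using LeastI_ex[OF that] ex[of "\<lambda>k. k = (LEAST k. free k)"] by (auto simp: free_def)
  let ?held = "\<lambda>j. j \<in> N \<and> bs ! p j" and ?sent = "\<lambda>j. j \<in> N \<and> os ! p j"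
    and ?arr = "\<lambda>j. j \<in> N \<and> snd (snd (ms ! p j))"
    and ?free = "\<lambda>j. j \<in> N \<and> (fst (ms ! p j) + 1) mod 3 = h \<and> \<not> fst (snd (ms ! p j))"
  have send_le: "w \<le> 0" if "send"
    using that by (simp add: send_def)
  \<comment> \<open>One case for each rule of \<open>node_step\<close>; \<open>send\<close> is split
    by whether the unit comes from the node's own weight or from a buffer.\<close>
  consider "cancel" | "send" "w < 0" | "send" "w = 0" | "\<not> cancel" "\<not> send"
    using send_le by linarith
  then show ?step
  proof cases
    case 1
    then have ns: "\<not> send" and pos: "w > 0" and "\<exists>k. held k" by (auto simp: cancel_def send_def)
    then obtain q where q: "q \<in> N" "p q = (LEAST k. held k)" "bs ! p q" using get_held by blast
    have "node_step w ?held ?sent ?arr ?free (w - 1) (\<lambda>j. ?held j \<and> j \<noteq> q \<or> ?arr j) (\<lambda>_. False)"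
      using pos q by (intro node_step.cancel) auto
    moreover have "(\<lambda>j. ?held j \<and> j \<noteq> q \<or> ?arr j) = (\<lambda>j. j \<in> N \<and> bs' ! p j)"
      using 1 q(1,3) p_less inj by (auto simp: fun_eq_iff bs' simp flip: q(2))
    moreover have "(\<lambda>_. False) = (\<lambda>j. j \<in> N \<and> os' ! p j)"
      using ns p_less by (auto simp: fun_eq_iff os')
    moreover have "w' = w - 1" using 1 by (simp add: w')
    ultimately show ?thesis by simp
  next
    case 2
    then have nc: "\<not> cancel" and "\<exists>k. free k" by (auto simp: cancel_def send_def)
    then obtain c where c: "c \<in> N" "p c = (LEAST k. free k)" "?free c" using get_free by blast
    have "node_step w ?held ?sent ?arr ?free (w + 1) (\<lambda>j. ?held j \<or> ?arr j) (\<lambda>j. j = c)"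
      using 2 c os_ex by (intro node_step.send_own) (auto simp: send_def)
    moreover have "(\<lambda>j. ?held j \<or> ?arr j) = (\<lambda>j. j \<in> N \<and> bs' ! p j)"
      using 2 nc p_less by (auto simp: fun_eq_iff bs')
    moreover have "(\<lambda>j. j = c) = (\<lambda>j. j \<in> N \<and> os' ! p j)"
      using 2 c(1,3) p_less inj by (auto simp: fun_eq_iff os' simp flip: c(2))
    moreover have "w' = w + 1" using 2 nc by (simp add: w')
    ultimately show ?thesis by simp
  next
    case 3
    then have nc: "\<not> cancel" and "\<exists>k. free k" and "\<exists>k. held k" by (auto simp: cancel_def send_def)
    then obtain c q where c: "c \<in> N" "p c = (LEAST k. free k)" "?free c"
      and q: "q \<in> N" "p q = (LEAST k. held k)" "bs ! p q" using get_free get_held by blast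
    have "node_step w ?held ?sent ?arr ?free w (\<lambda>j. ?held j \<and> j \<noteq> q \<or> ?arr j) (\<lambda>j. j = c)"
      using 3 c q os_ex by (intro node_step.send_held) (auto simp: send_def)
    moreover have "(\<lambda>j. ?held j \<and> j \<noteq> q \<or> ?arr j) = (\<lambda>j. j \<in> N \<and> bs' ! p j)"
      using 3 q(1,3) p_less inj by (auto simp: fun_eq_iff bs' simp flip: q(2))
    moreover have "(\<lambda>j. j = c) = (\<lambda>j. j \<in> N \<and> os' ! p j)"
      using 3 c(1,3) p_less inj by (auto simp: fun_eq_iff os' simp flip: c(2))
    moreover have "w' = w" using 3 nc by (simp add: w')
    ultimately show ?thesis by simp
  next
    case 4
    have "node_step w ?held ?sent ?arr ?free w (\<lambda>j. ?held j \<or> ?arr j) (\<lambda>_. False)"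
    proof (rule node_step.idle)
      show "\<not> (w > 0 \<and> (\<exists>j. ?held j))"
        using 4(1) held_ex by (simp add: cancel_def)
      show "\<not> (w \<le> 0 \<and> (w < 0 \<or> (\<exists>j. ?held j)) \<and> (\<forall>j. \<not> ?sent j) \<and> (\<exists>j. ?free j))"
        using 4(2) by (simp only: send_def held_ex free_ex os_ex not_ex) simp
    qed
    moreover have "(\<lambda>j. ?held j \<or> ?arr j) = (\<lambda>j. j \<in> N \<and> bs' ! p j)"
      using 4 p_less by (auto simp: fun_eq_iff bs')
    moreover have "(\<lambda>_. False) = (\<lambda>j. j \<in> N \<and> os' ! p j)"
      using 4 p_less by (auto simp: fun_eq_iff os')
    moreover have "w' = w" using 4 by (simp add: w')
    ultimately show ?thesis by simp
  qed
qed

section \<open>Runs of a single test on a network\<close>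

primrec loc_run ::
  "(nat \<Rightarrow> nat \<Rightarrow> bool) \<Rightarrow> (nat \<Rightarrow> nat \<Rightarrow> nat) \<Rightarrow> (nat \<Rightarrow> int) \<Rightarrow> nat \<Rightarrow> nat \<Rightarrow> loc" where
  "loc_run E l v 0 = (\<lambda>i. loc_init (v i) (deg E i))"
| "loc_run E l v (Suc t) = (\<lambda>i. loc_step (loc_run E l v t i)
     (map (\<lambda>k. let j = port_nbr E l i k in loc_send (loc_run E l v t j) (l j i - 1))
       [1..<deg E i + 1]))"

lemma port_nbr_bij:
  assumes "network n E l" "i \<in> {1..n}"
  shows "bij_betw (port_nbr E l i) {1..deg E i} (nbrs E i)"
    and "E i j \<Longrightarrow> port_nbr E l i (l i j) = j"
proof -
  have bij: "bij_betw (l i) (nbrs E i) {1..deg E i}"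
    using assms by (simp add: network_def)
  show *: "E i j \<Longrightarrow> port_nbr E l i (l i j) = j" for j
    unfolding port_nbr_def using bij_betw_imp_inj_on[OF bij]
    by (intro the_equality) (auto simp: nbrs_def dest: inj_onD)
  have "E i (port_nbr E l i k) \<and> l i (port_nbr E l i k) = k" if "k \<in> {1..deg E i}" for k
  proof -
    have "k \<in> l i ` nbrs E i" using bij_betw_imp_surj_on[OF bij] that by simp
    then show ?thesis using * by (auto simp: nbrs_def)
  qed
  then show "bij_betw (port_nbr E l i) {1..deg E i} (nbrs E i)"
    using bij_betwE[OF bij] * by (intro bij_betw_byWitness[where f' = "l i"]) (auto simp: nbrs_def)
qed

lemma port_range:
  assumes "network n E l" "E i j"
  shows "1 \<le> l i j" "l i j \<le> deg E i"
proof -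
  have "i \<in> {1..n}" using assms unfolding network_def by blast
  then have "bij_betw (l i) (nbrs E i) {1..deg E i}"
    using assms(1) by (simp add: network_def)
  moreover have "j \<in> nbrs E i" using assms(2) by (simp add: nbrs_def)
  ultimately have "l i j \<in> {1..deg E i}" by (auto dest: bij_betwE)
  then show "1 \<le> l i j" "l i j \<le> deg E i" by auto
qed

lemma port_bij0:
  assumes "network n E l" "i \<in> {1..n}"
  shows "bij_betw (\<lambda>j. l i j - 1) (nbrs E i) {..<deg E i}"
proof -
  have "bij_betw (l i) (nbrs E i) {1..deg E i}"
    using assms by (simp add: network_def)
  moreover have "bij_betw (\<lambda>k. k - 1) {1..deg E i} {..<deg E i}"
    by (rule bij_betw_byWitness[where f' = Suc]) auto
  ultimately show ?thesis
    using bij_betw_trans by (fastforce simp: comp_def)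
qed

text \<open>The actual height is recovered from a run by counting rises.\<close>
primrec height :: "(nat \<Rightarrow> nat \<Rightarrow> loc) \<Rightarrow> nat \<Rightarrow> nat \<Rightarrow> nat" where
  "height S 0 i = 0"
| "height S (Suc t) i = height S t i + of_bool (risen (S (Suc t) i))"

fun weight :: "loc \<Rightarrow> int" where "weight (w, h, r, bs, os) = w"
fun phase :: "loc \<Rightarrow> nat" where "phase (w, h, r, bs, os) = h"
fun held :: "loc \<Rightarrow> bool list" where "held (w, h, r, bs, os) = bs"
fun sent :: "loc \<Rightarrow> bool list" where "sent (w, h, r, bs, os) = os"

lemma loc_eta: "s = (weight s, phase s, risen s, held s, sent s)"
  by (cases s) simp

lemma loc_send_eq: "loc_send s k = (phase s, held s ! k, sent s ! k)"
  by (cases s) simp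

text \<open>The link is the invariant that the stored phase is the counted height modulo 3, so the
  comparisons made by the automaton are those of the locale. The second claim identifies the visible
  bit with the locale's \<open>rises\<close>.\<close>

lemma loc_run_dynamics:
  fixes E l v
  assumes net: "network n E l"
  defines "S \<equiv> loc_run E l v"
  defines "h \<equiv> height S"
    and "B \<equiv> \<lambda>t i j. E i j \<and> held (S t i) ! (l i j - 1)"
    and "F \<equiv> \<lambda>t i j. E i j \<and> sent (S t i) ! (l i j - 1)"
  shows "height_dynamics {1..n} E (\<lambda>t i. weight (S t i)) h B F"
    and "i \<in> {1..n} \<Longrightarrow> risen (S (Suc t) i) \<longleftrightarrow>
      weight (S t i) \<le> 0 \<and> \<not> (\<exists>j. E i j \<and> (h t j + 1) mod 3 = h t i mod 3)"
proof -
  have sym: "E i j \<Longrightarrow> E j i" and edge: "E i j \<Longrightarrow> i \<in> {1..n} \<and> j \<in> {1..n}" for i j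
    using net unfolding network_def by blast+
  define ms where "ms t i = map (\<lambda>k. let j = port_nbr E l i k in loc_send (S t j) (l j i - 1))
       [1..<deg E i + 1]" for t i
  have S_0: "S 0 i = loc_init (v i) (deg E i)" for i by (simp add: S_def)
  have S_Suc: "S (Suc t) i = loc_step (S t i) (ms t i)" for t i
    by (simp add: S_def ms_def)
  \<comment> \<open>Ports are numbered from 1 but list entries from 0, hence the shift on both ends
    of the edge.\<close>
  have ms_nth: "ms t i ! (l i j - 1) = loc_send (S t j) (l j i - 1)" if "E i j" for t i j
  proof -
    have "i \<in> {1..n}" using edge that by blast
    then show ?thesis
      using port_range[OF net that] port_nbr_bij(2)[OF net _ that]
      by (simp add: ms_def nth_append del: upt_Suc)
  qed
  have inv: "length (held (S t i)) = deg E i \<and> length (sent (S t i)) = deg E i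
      \<and> phase (S t i) = h t i mod 3" if i: "i \<in> {1..n}" for t i
  proof (induction t)
    case 0
    then show ?case by (simp add: S_0 loc_init_def h_def)
  next
    case (Suc t)
    obtain w hh r bs os where St: "S t i = (w, hh, r, bs, os)" by (metis surj_pair)
    obtain w' h' r' bs' os' where St': "S (Suc t) i = (w', h', r', bs', os')" by (metis surj_pair)
    have len: "length bs = deg E i" "length os = deg E i" and hh: "hh = h t i mod 3"
      using Suc by (simp_all add: St)
    have "loc_step (w, hh, r, bs, os) (ms t i) = (w', h', r', bs', os')"
      using S_Suc[of t i] by (simp add: St St')
    note * = loc_step_node_step[OF port_bij0[OF net i] len this]
    show ?case
      using *(3-5) by (simp add: St' hh h_def mod_Suc_eq)
  qed
  have stp: "node_step (weight (S t i)) (B t i) (F t i) (\<lambda>j. F t j i)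
        (\<lambda>j. E i j \<and> (h t j + 1) mod 3 = h t i mod 3 \<and> \<not> B t j i)
        (weight (S (Suc t) i)) (B (Suc t) i) (F (Suc t) i)"
    (is "node_step _ _ _ ?arr ?free _ _ _")
    and rise: "risen (S (Suc t) i) \<longleftrightarrow>
      weight (S t i) \<le> 0 \<and> \<not> (\<exists>j. E i j \<and> (h t j + 1) mod 3 = h t i mod 3)"
    if i: "i \<in> {1..n}" for t i
  proof -
    have "loc_step (weight (S t i), phase (S t i), risen (S t i), held (S t i), sent (S t i)) (ms t i)
      = (weight (S (Suc t) i), phase (S (Suc t) i), risen (S (Suc t) i), held (S (Suc t) i),
          sent (S (Suc t) i))"
      using S_Suc[of t i] by (simp flip: loc_eta)
    note * = loc_step_node_step[OF port_bij0[OF net i] _ _ this]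
    have low: "(fst (ms t i ! (l i j - 1)) + 1) mod 3 = phase (S t i) \<longleftrightarrow>
        (h t j + 1) mod 3 = h t i mod 3" if "E i j" for j
      using inv[OF i, of t] inv[of j t] edge[OF that]
      by (simp only: ms_nth[OF that] loc_send_eq fst_conv) (simp add: mod_Suc_eq)
    have arr: "(\<lambda>j. j \<in> nbrs E i \<and> snd (snd (ms t i ! (l i j - 1)))) = ?arr"
    proof
      fix j
      show "(j \<in> nbrs E i \<and> snd (snd (ms t i ! (l i j - 1)))) = ?arr j"
      proof (cases "E i j")
        case True
        then show ?thesis using sym[OF True]
          by (simp only: ms_nth[OF True]) (auto simp: nbrs_def loc_send_eq F_def)
      qed (use sym in \<open>auto simp: nbrs_def F_def\<close>)
    qed
    have free: "(\<lambda>j. j \<in> nbrs E i \<and> (fst (ms t i ! (l i j - 1)) + 1) mod 3 = phase (S t i)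
        \<and> \<not> fst (snd (ms t i ! (l i j - 1)))) = ?free"
    proof
      fix j
      show "(j \<in> nbrs E i \<and> (fst (ms t i ! (l i j - 1)) + 1) mod 3 = phase (S t i)
        \<and> \<not> fst (snd (ms t i ! (l i j - 1)))) = ?free j"
      proof (cases "E i j")
        case True
        show ?thesis using low[OF True] sym[OF True] True
          by (simp only: ms_nth[OF True]) (auto simp: nbrs_def loc_send_eq B_def)
      qed (simp add: nbrs_def)
    qed
    have held: "(\<lambda>j. j \<in> nbrs E i \<and> held (S t i) ! (l i j - 1)) = B t i" for t
      by (simp add: nbrs_def B_def)
    have sent: "(\<lambda>j. j \<in> nbrs E i \<and> sent (S t i) ! (l i j - 1)) = F t i" for t
      by (simp add: nbrs_def F_def)
    have len: "length (held (S t i)) = deg E i" "length (sent (S t i)) = deg E i"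
      using inv[OF i] by auto
    show "node_step (weight (S t i)) (B t i) (F t i) ?arr ?free
        (weight (S (Suc t) i)) (B (Suc t) i) (F (Suc t) i)"
      using *(1)[OF len] by (simp only: held sent arr free)
    show "risen (S (Suc t) i) \<longleftrightarrow>
      weight (S t i) \<le> 0 \<and> \<not> (\<exists>j. E i j \<and> (h t j + 1) mod 3 = h t i mod 3)"
      using *(2)[OF len] low by (auto simp: nbrs_def)
  qed
  show "i \<in> {1..n} \<Longrightarrow> risen (S (Suc t) i) \<longleftrightarrow>
      weight (S t i) \<le> 0 \<and> \<not> (\<exists>j. E i j \<and> (h t j + 1) mod 3 = h t i mod 3)"
    by (rule rise)
  \<comment> \<open>\<open>port_range\<close> puts the index inside the initial
    all-\<open>False\<close> lists, where the value of \<open>!\<close> is known.\<close>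
  have init: "\<not> B 0 i j" "\<not> F 0 i j" for i j
    using port_range[OF net] by (fastforce simp: B_def F_def S_0 loc_init_def)+
  show "height_dynamics {1..n} E (\<lambda>t i. weight (S t i)) h B F"
  proof
    show "i \<in> {1..n} \<Longrightarrow> j \<in> {1..n} \<Longrightarrow> E\<^sup>*\<^sup>* i j" "{1..n} \<noteq> {}" for i j
      using net by (simp_all add: network_def)
  qed (use sym edge init stp rise in \<open>auto simp: h_def B_def F_def\<close>)
qed

lemma loc_run_decides:
  assumes net: "network n E l"
  shows "\<exists>T. \<forall>t\<ge>T. \<forall>i\<in>{1..n}. risen (loc_run E l v t i) \<longleftrightarrow> \<not> (\<Sum>i\<in>{1..n}. v i) > 0"
proof -
  let ?S = "loc_run E l v"
  interpret height_dynamics "{1..n}" E "\<lambda>t i. weight (?S t i)" "height ?S"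
    "\<lambda>t i j. E i j \<and> held (?S t i) ! (l i j - 1)"
    "\<lambda>t i j. E i j \<and> sent (?S t i) ! (l i j - 1)"
    "\<lambda>t i j. (height ?S t j + 1) mod 3 = height ?S t i mod 3"
    "\<lambda>t i. weight (?S t i) \<le> 0 \<and> \<not> (\<exists>j. E i j \<and> (height ?S t j + 1) mod 3 = height ?S t i mod 3)"
    using loc_run_dynamics(1)[OF net] by simp_all
  have sum_0: "(\<Sum>i\<in>{1..n}. weight (?S 0 i)) = (\<Sum>i\<in>{1..n}. v i)"
    by (simp add: loc_init_def)
  have *: "\<exists>T. \<forall>t\<ge>T. \<forall>i\<in>{1..n}. risen (?S (Suc t) i) \<longleftrightarrow> \<not> (\<Sum>i\<in>{1..n}. v i) > 0"
    using test_positive test_nonpositive loc_run_dynamics(2)[OF net, of _ v]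
    unfolding sum_0 by (cases "(\<Sum>i\<in>{1..n}. v i) > 0") (meson, meson not_less)
  then obtain T where "\<And>t i. t \<ge> T \<Longrightarrow> i \<in> {1..n} \<Longrightarrow>
      risen (?S (Suc t) i) \<longleftrightarrow> \<not> (\<Sum>i\<in>{1..n}. v i) > 0" by blast
  \<comment> \<open>The bit stored at time \<open>Suc t\<close> reports the rise decided at time
    \<open>t\<close>, so the threshold moves by one.\<close>
  then have "\<forall>t\<ge>Suc T. \<forall>i\<in>{1..n}. risen (?S t i) \<longleftrightarrow> \<not> (\<Sum>i\<in>{1..n}. v i) > 0"
    by (metis Suc_le_D Suc_le_mono)
  then show ?thesis by blast
qed

section \<open>Running all tests in parallel\<close>

text \<open>Test \<open>k \<le> K\<close> asks whether the average exceeds \<open>k\<close>, test \<open>K + 1 + k\<close> whether it is below \<open>k\<close>.\<close>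
definition test_weight :: "nat \<Rightarrow> nat \<Rightarrow> nat \<Rightarrow> int" where
  "test_weight K \<tau> x = (if \<tau> \<le> K then int x - int \<tau> else int (\<tau> - (K + 1)) - int x)"

text \<open>The average is \<open>k\<close> iff it is neither above nor below \<open>k\<close>. The
  fallback \<open>{}\<close> covers inconsistent answers before the tests have settled and keeps
  every output in \<open>Yavg K\<close>.\<close>

definition decide :: "nat \<Rightarrow> (nat \<Rightarrow> bool) \<Rightarrow> real set" where
  "decide K p =
    (let exact = (\<lambda>k. k \<le> K \<and> \<not> p k \<and> \<not> p (K + 1 + k));
         strict = (\<lambda>k. k < K \<and> p k \<and> p (K + 1 + (k + 1)))
     in if \<exists>k. exact k then {real (LEAST k. exact k)}
        else if \<exists>k. strict k then {real (LEAST k. strict k)<..<real (LEAST k. strict k) + 1}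
        else {})"

lemma decide_in_Yavg: "decide K p \<in> Yavg K"
proof -
  let ?e = "\<lambda>k. k \<le> K \<and> \<not> p k \<and> \<not> p (K + 1 + k)"
    and ?s = "\<lambda>k. k < K \<and> p k \<and> p (K + 1 + (k + 1))"
  show ?thesis
    using LeastI_ex[of ?e] LeastI_ex[of ?s]
    unfolding decide_def Yavg_def Let_def by (simp split: if_split) blast
qed

text \<open>Distinct unit intervals with integer endpoints are disjoint, and none of them contains
  an integer. This justifies the description operator in \<open>favg\<close>.\<close>

lemma Yavg_unique:
  assumes "y \<in> Yavg K" "y' \<in> Yavg K" "a \<in> y" "a \<in> y'"
  shows "y = y'"
proof -
  have *: "k < k' \<and> k' < k + 1" if "real k < real k'" "real k' < real k + 1" for k k' :: nat
    using that by linarith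
  have **: "k = k'" if "real k < a" "a < real k + 1" "real k' < a" "a < real k' + 1" for k k' :: nat
    using that by linarith
  show ?thesis
    using assms by (auto simp: Yavg_def dest: * **)
qed

lemma decide_correct:
  assumes n: "n \<ge> 1" and x: "\<And>i. i \<in> {1..n} \<Longrightarrow> x i \<le> K"
    and p: "\<And>\<tau>. \<tau> < 2 * K + 2 \<Longrightarrow> p \<tau> \<longleftrightarrow> (\<Sum>i=1..n. test_weight K \<tau> (x i)) > 0"
  shows "decide K p = favg K n x"
proof -
  define s where "s = (\<Sum>i=1..n. x i)"
  have above: "p k \<longleftrightarrow> k * n < s" if "k \<le> K" for k
  proof -
    have "(\<Sum>i=1..n. test_weight K k (x i)) = int s - int (k * n)"
      using that by (simp add: test_weight_def s_def sum_subtractf mult.commute)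
    then have "p k \<longleftrightarrow> int (k * n) < int s" using p[of k] that by simp
    then show ?thesis by (simp only: of_nat_less_iff)
  qed
  have below: "p (K + 1 + k) \<longleftrightarrow> s < k * n" if "k \<le> K" for k
  proof -
    have "(\<Sum>i=1..n. test_weight K (K + 1 + k) (x i)) = int (k * n) - int s"
      using that by (simp add: test_weight_def s_def sum_subtractf mult.commute)
    then have "p (K + 1 + k) \<longleftrightarrow> int s < int (k * n)" using p[of "K + 1 + k"] that by simp
    then show ?thesis by (simp only: of_nat_less_iff)
  qed
  let ?e = "\<lambda>k. k \<le> K \<and> \<not> p k \<and> \<not> p (K + 1 + k)"
    and ?s = "\<lambda>k. k < K \<and> p k \<and> p (K + 1 + (k + 1))"
  have e: "?e k \<longleftrightarrow> k \<le> K \<and> s = k * n" for k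
    using above[of k] below[of k] by auto
  have s: "?s k \<longleftrightarrow> k < K \<and> k * n < s \<and> s < (k + 1) * n" for k
    using above[of k] below[of "k + 1"] by auto
  have avg: "(\<Sum>i=1..n. real (x i)) / real n = real s / real n"
    by (simp add: s_def)
  have "real s / real n \<in> decide K p"
  proof (cases "\<exists>k. ?e k")
    case True
    define m where "m = (LEAST k. ?e k)"
    have "?e m" unfolding m_def by (rule LeastI_ex[OF True])
    then have "s = m * n" unfolding e ..
    then have "real s / real n = real m" using n by simp
    moreover have "decide K p = {real m}"
      using True unfolding decide_def m_def Let_def by (simp only: if_True)
    ultimately show ?thesis by simp
  next
    case False
    have "s \<le> (\<Sum>i=1..n. K)"
      unfolding s_def using x by (intro sum_mono) auto
    then have sK: "s \<le> K * n" by (simp add: mult.commute)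
    \<comment> \<open>The floor of the average is the left endpoint. \<open>s \<le> K * n\<close>
      gives \<open>k \<le> K\<close>; since the average is not an integer in range,
      \<open>k * n < s\<close>, and so \<open>k < K\<close>.\<close>
    define k where "k = s div n"
    have k: "k * n \<le> s" "s < (k + 1) * n"
      using n dividend_less_div_times[of n s] by (auto simp: k_def)
    have "k * n < (K + 1) * n" using k sK n by auto
    then have "k < K + 1" by (simp only: mult_less_cancel2)
    then have ne: "s \<noteq> k * n" using False[unfolded not_ex, THEN spec, of k] unfolding e by linarith
    have "k * n < K * n" using ne k(1) sK by linarith
    then have "?s k" unfolding s using k ne by simp
    then have ex: "\<exists>k. ?s k" by (rule exI)
    define m where "m = (LEAST k. ?s k)"
    have "?s m" unfolding m_def by (rule LeastI_ex[OF ex])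
    then have "m * n < s" "s < (m + 1) * n" unfolding s by blast+
    then have "real (m * n) < real s" "real s < real ((m + 1) * n)" by (simp_all only: of_nat_less_iff)
    then have "real m < real s / real n" "real s / real n < real m + 1"
      using n by (simp_all add: field_simps)
    moreover have "decide K p = {real m<..<real m + 1}"
      using False ex unfolding decide_def m_def Let_def by (simp only: if_True if_False simp_thms)
    ultimately show ?thesis by simp
  qed
  then show ?thesis
    unfolding favg_def avg using decide_in_Yavg[of K p]
    by (intro the_equality[symmetric] conjI) (simp_all, metis Yavg_unique)
qed

section \<open>The combined automaton and its execution\<close>

definition node_init :: "nat \<Rightarrow> nat \<Rightarrow> nat \<Rightarrow> loc list" where
  "node_init K x d = map (\<lambda>\<tau>. loc_init (test_weight K \<tau> x) d) [0..<2 * K + 2]"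

definition node_update :: "nat \<Rightarrow> loc list \<Rightarrow> lmsg list list \<Rightarrow> loc list" where
  "node_update K ss mss = map (\<lambda>\<tau>. loc_step (ss ! \<tau>) (map (\<lambda>m. m ! \<tau>) mss)) [0..<2 * K + 2]"

definition node_send :: "loc list \<Rightarrow> nat \<Rightarrow> lmsg list" where
  "node_send ss k = map (\<lambda>s. loc_send s k) ss"

text \<open>\<open>Suc\<close> keeps every encoded memory apart from 0, the mark of the first step.
  The risen bit is negated because a test is positive exactly when rises stop.\<close>

definition node_state :: "nat \<Rightarrow> nat \<Rightarrow> nat \<Rightarrow> loc list \<Rightarrow> (nat, nat, real set, nat) nstate" where
  "node_state K d x ss = (x, Suc (to_nat ss), decide K (\<lambda>\<tau>. \<not> risen (ss ! \<tau>)),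
     map (\<lambda>k. to_nat (node_send ss k)) [0..<d])"

text \<open>Memory 0 marks the very first step, in which the incoming messages carry no information yet.\<close>
fun automaton :: "nat \<Rightarrow> nat \<Rightarrow> (nat, nat, real set, nat) nstate \<Rightarrow> (nat, nat, real set, nat) nstate"
  where
  "automaton K d (x, z, y, ms) = node_state K d x
    (if z = 0 then node_init K x d else node_update K (from_nat (z - 1)) (map from_nat ms))"

text \<open>The first step only installs the initial test states and ignores the incoming messages,
  so global time \<open>Suc t\<close> corresponds to time \<open>t\<close> of each test.\<close>

lemma exec_automaton:
  assumes net: "network n E l" and i: "i \<in> {1..n}"
  shows "exec (automaton K) 0 y0 0 E l x (Suc t) i = node_state K (deg E i) (x i)
    (map (\<lambda>\<tau>. loc_run E l (\<lambda>i. test_weight K \<tau> (x i)) t i) [0..<2 * K + 2])"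
  using i
proof (induction t arbitrary: i)
  case 0
  then show ?case by (simp add: node_init_def del: upt_Suc)
next
  case (Suc t)
  let ?X = "exec (automaton K) 0 y0 0 E l x (Suc t)"
  let ?R = "\<lambda>\<tau>. loc_run E l (\<lambda>i. test_weight K \<tau> (x i)) t"
  let ?ss = "\<lambda>i. map (\<lambda>\<tau>. ?R \<tau> i) [0..<2 * K + 2]"
  let ?ms = "map (\<lambda>k. let j = port_nbr E l i k in msgs (?X j) ! (l j i - 1)) [1..<deg E i + 1]"
  have ms: "map from_nat ?ms
    = map (\<lambda>k. let j = port_nbr E l i k in node_send (?ss j) (l j i - 1)) [1..<deg E i + 1]"
    unfolding map_map comp_def
  proof (rule map_cong[OF refl])
    fix k assume "k \<in> set [1..<deg E i + 1]"
    then have "k \<in> {1..deg E i}" by auto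
    then have "port_nbr E l i k \<in> nbrs E i"
      using port_nbr_bij(1)[OF net Suc.prems] by (auto dest: bij_betwE)
    then have E: "E (port_nbr E l i k) i"
      using net unfolding nbrs_def network_def by blast
    then have j: "port_nbr E l i k \<in> {1..n}" using net unfolding network_def by blast
    \<comment> \<open>An index in range makes \<open>!\<close> return a genuine encoding, which
      \<open>from_nat\<close> inverts.\<close>
    have "l (port_nbr E l i k) i - 1 < deg E (port_nbr E l i k)"
      using port_range[OF net E] by linarith
    then show "from_nat (let j = port_nbr E l i k in msgs (?X j) ! (l j i - 1))
      = (let j = port_nbr E l i k in node_send (?ss j) (l j i - 1))"
      unfolding Let_def Suc.IH[OF j]
      by (simp add: node_state_def msgs_def del: upt_Suc)
  qed
  have "exec (automaton K) 0 y0 0 E l x (Suc (Suc t)) i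
    = node_state K (deg E i) (x i) (node_update K (?ss i) (map from_nat ?ms))"
    by (subst exec.simps(2), subst Suc.IH[OF Suc.prems])
      (simp add: node_state_def del: upt_Suc exec.simps)
  also have "node_update K (?ss i) (map from_nat ?ms)
    = map (\<lambda>\<tau>. loc_run E l (\<lambda>i. test_weight K \<tau> (x i)) (Suc t) i) [0..<2 * K + 2]"
    unfolding ms node_update_def
    by (rule map_cong[OF refl]) (simp add: node_send_def comp_def Let_def del: upt_Suc)
  finally show ?case .
qed

lemma final_output_automaton:
  assumes net: "network n E l" and x: "\<forall>i\<in>{1..n}. x i \<in> Xavg K"
  shows "final_output n (exec (automaton K) 0 y0 0 E l x) (favg K n x)"
proof -
  let ?R = "\<lambda>\<tau>. loc_run E l (\<lambda>i. test_weight K \<tau> (x i))"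
  let ?p = "\<lambda>\<tau>. (\<Sum>i\<in>{1..n}. test_weight K \<tau> (x i)) > 0"
  have "\<exists>T. \<forall>t\<ge>T. \<forall>\<tau>\<in>{..<2 * K + 2}. \<forall>i\<in>{1..n}. risen (?R \<tau> t i) \<longleftrightarrow> \<not> ?p \<tau>"
    by (rule finite_uniform_threshold[of "{..<2 * K + 2}"]) (simp, rule loc_run_decides[OF net])
  then obtain T where T: "\<And>t \<tau> i. t \<ge> T \<Longrightarrow> \<tau> < 2 * K + 2 \<Longrightarrow> i \<in> {1..n} \<Longrightarrow>
      risen (?R \<tau> t i) \<longleftrightarrow> \<not> ?p \<tau>"
    by (metis lessThan_iff)
  have "outp (exec (automaton K) 0 y0 0 E l x t i) = favg K n x"
    if "t \<ge> Suc T" "i \<in> {1..n}" for t i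
  proof -
    obtain s where s: "t = Suc s" "s \<ge> T" using \<open>t \<ge> Suc T\<close> by (cases t) auto
    have "decide K (\<lambda>\<tau>. \<not> risen (map (\<lambda>\<tau>. ?R \<tau> s i) [0..<2 * K + 2] ! \<tau>)) = favg K n x"
    proof (rule decide_correct)
      show "n \<ge> 1" using net by (simp add: network_def)
      show "x i \<le> K" if "i \<in> {1..n}" for i using x that by (auto simp: Xavg_def)
    qed (simp add: T[OF s(2) _ that(2)] del: upt_Suc)
    then show ?thesis
      by (simp add: s(1) exec_automaton[OF net that(2)] node_state_def outp_def del: upt_Suc exec.simps)
  qed
  then show ?thesis unfolding final_output_def by blast
qed

section \<open>Finiteness and size of the memory\<close>

definition locs :: "nat \<Rightarrow> nat \<Rightarrow> loc set" where
  "locs K d = {- int K..int K} \<times> {..<3} \<times> UNIV \<times> {bs. set bs \<subseteq> UNIV \<and> length bs = d}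
     \<times> {os. set os \<subseteq> UNIV \<and> length os = d}"

definition node_states :: "nat \<Rightarrow> nat \<Rightarrow> loc list set" where
  "node_states K d = {ss. set ss \<subseteq> locs K d \<and> length ss = 2 * K + 2}"

definition memories :: "nat \<Rightarrow> nat \<Rightarrow> nat set" where
  "memories K d = insert 0 ((Suc \<circ> to_nat) ` node_states K d)"

definition messages :: "nat \<Rightarrow> nat set" where
  "messages K = insert 0 (to_nat ` {ms :: lmsg list. set ms \<subseteq> {..<3} \<times> UNIV \<and> length ms = 2 * K + 2})"

lemma finite_locs: "finite (locs K d)"
  unfolding locs_def by (intro finite_cartesian_product finite_lists_length_eq) auto

text \<open>The factor 6 counts three phases times the risen bit; the two bit lists contribute
  \<open>2 ^ d\<close> each.\<close>

lemma card_locs: "card (locs K d) = (2 * K + 1) * 6 * 4 ^ d"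
proof -
  have "card {bs :: bool list. set bs \<subseteq> UNIV \<and> length bs = d} = 2 ^ d"
    by (subst card_lists_length_eq) auto
  moreover have "(4 :: nat) ^ d = 2 ^ d * 2 ^ d"
    by (simp flip: power_mult_distrib)
  ultimately show ?thesis
    by (simp add: locs_def card_cartesian_product)
qed

lemma card_memories: "card (memories K d) \<le> ((2 * K + 1) * 6 * 4 ^ d) ^ (2 * K + 2) + 1"
proof -
  have "finite (node_states K d)"
    unfolding node_states_def by (intro finite_lists_length_eq finite_locs)
  then have "card (memories K d) \<le> Suc (card (node_states K d))"
    using card_image_le[of "node_states K d" "Suc \<circ> to_nat"]
    by (simp add: memories_def card_insert_if del: comp_apply)
  then show ?thesis
    unfolding node_states_def using finite_locs by (simp add: card_lists_length_eq card_locs)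
qed

lemma finite_memory_automaton: "finite_memory (Xavg K) (Yavg K) (memories K) (messages K)"
proof -
  have "finite {{real k} | k. k \<le> K}" "finite {{real k<..<real k + 1} | k. k < K}"
    by simp_all
  then have Y: "finite (Yavg K)" by (simp add: Yavg_def)
  have M: "finite (messages K)"
    unfolding messages_def by (intro finite.insertI finite_imageI finite_lists_length_eq) auto
  have Z: "finite (memories K d)" for d
    unfolding memories_def node_states_def
    by (intro finite.insertI finite_imageI finite_lists_length_eq finite_locs)
  \<comment> \<open>48 = 2 * 6 * 4: the 2 absorbs the extra memory 0, the 6 comes from phase and
    bit, the 4 from the two bits per port. Since \<open>d \<ge> 1\<close>, the constant factor can
    be raised to the power \<open>d\<close> as well.\<close>
  define a where "a = (2 * K + 1) * 48"
  have "log 2 (real (card (memories K d))) \<le> (real (2 * K + 2) * log 2 (real a)) * real d"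
    if d: "d \<ge> 1" for d
  proof -
    define m where "m = (2 * K + 1) * 6 * 4 ^ d"
    have "m \<ge> 1" by (simp add: m_def)
    have ma: "2 * m \<le> a ^ d"
    proof -
      have "2 * m = ((2 * K + 1) * 12) ^ 1 * 4 ^ d" by (simp add: m_def)
      also have "\<dots> \<le> ((2 * K + 1) * 12) ^ d * 4 ^ d"
        using d by (intro mult_right_mono power_increasing) auto
      also have "\<dots> = a ^ d" by (simp add: a_def flip: power_mult_distrib)
      finally show ?thesis .
    qed
    have "card (memories K d) \<le> m ^ (2 * K + 2) + 1"
      using card_memories by (simp add: m_def)
    also have "\<dots> \<le> 2 * m ^ (2 * K + 2)" using \<open>m \<ge> 1\<close> by simp
    also have "\<dots> \<le> 2 ^ (2 * K + 2) * m ^ (2 * K + 2)" by simp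
    also have "\<dots> = (2 * m) ^ (2 * K + 2)" by (simp only: power_mult_distrib)
    also have "\<dots> \<le> (a ^ d) ^ (2 * K + 2)" by (rule power_mono[OF ma]) simp
    finally have le: "card (memories K d) \<le> a ^ (d * (2 * K + 2))"
      by (simp only: power_mult)
    have "card (memories K d) > 0"
      using Z by (auto simp: card_gt_0_iff memories_def)
    then have "log 2 (real (card (memories K d))) \<le> log 2 (real (a ^ (d * (2 * K + 2))))"
      using le by (subst log_le_cancel_iff) (simp_all add: a_def del: of_nat_power)
    also have "\<dots> = (real (2 * K + 2) * log 2 (real a)) * real d"
      by (simp add: log_nat_power a_def algebra_simps)
    finally show ?thesis .
  qed
  then show ?thesis
    unfolding finite_memory_def using Y M Z by (auto simp: Xavg_def)
qed

lemma loc_init_in: "x \<le> K \<Longrightarrow> \<tau> < 2 * K + 2 \<Longrightarrow> loc_init (test_weight K \<tau> x) d \<in> locs K d"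
  by (auto simp: loc_init_def locs_def test_weight_def)

text \<open>The weight stays within its bounds because it decreases only when positive and increases
  only when negative.\<close>

lemma loc_step_in: "s \<in> locs K d \<Longrightarrow> loc_step s ms \<in> locs K d"
  by (cases s) (auto simp: locs_def Let_def)

lemma node_send_in:
  assumes "ss \<in> node_states K d"
  shows "to_nat (node_send ss k) \<in> messages K"
proof -
  have "set (node_send ss k) \<subseteq> {..<3} \<times> UNIV"
    using assms by (fastforce simp: node_send_def node_states_def locs_def)
  then show ?thesis
    using assms by (auto simp: messages_def node_send_def node_states_def)
qed

lemma automaton_family_automaton:
  "automaton_family (Xavg K) (Yavg K) (memories K) (messages K) (automaton K)"
  unfolding automaton_family_def
proof (intro allI impI)
  fix d x z y and ms :: "nat list"
  assume x: "x \<in> Xavg K" and z: "z \<in> memories K d"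
  define ss where
    "ss = (if z = 0 then node_init K x d else node_update K (from_nat (z - 1)) (map from_nat ms))"
  have ss: "ss \<in> node_states K d"
  proof (cases "z = 0")
    case True
    then show ?thesis
      using x by (auto simp: ss_def node_init_def node_states_def Xavg_def loc_init_in simp del: upt_Suc)
  next
    case False
    then obtain ss0 where ss0: "ss0 \<in> node_states K d" "z = Suc (to_nat ss0)"
      using z by (auto simp: memories_def)
    then have "ss0 ! \<tau> \<in> locs K d" if "\<tau> < 2 * K + 2" for \<tau>
      using that by (auto simp: node_states_def)
    then show ?thesis
      by (auto simp: ss_def ss0(2) node_update_def node_states_def loc_step_in simp del: upt_Suc)
  qed
  have "automaton K d (x, z, y, ms) = node_state K d x ss"
    by (simp add: ss_def)
  then show "case automaton K d (x, z, y, ms) of (xv', z', y', ms') \<Rightarrow>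
      xv' = x \<and> z' \<in> memories K d \<and> y' \<in> Yavg K \<and> set ms' \<subseteq> messages K \<and> length ms' = d"
    using ss by (auto simp: node_state_def decide_in_Yavg memories_def node_send_in)
qed

theorem theorem2:
  fixes K :: nat
  shows "computable (Xavg K) (Yavg K) {} (favg K)"
  unfolding computable_def
proof (intro exI conjI allI impI)
  show "0 \<in> messages K" "0 \<in> memories K d" for d
    by (simp_all add: messages_def memories_def)
  show "{} \<in> Yavg K" by (simp add: Yavg_def)
qed (use automaton_family_automaton finite_memory_automaton final_output_automaton in auto)

end
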